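(* There is an absolute constant $c>0$ such that the following holds. Let $n\ge 4$ be an integer and let $$\rho_n(z)=\sum_{k=1}^m\frac{n_k}{z-\xi_k}$$ be a simple partial fraction of order $n=\sum_{k=1}^m n_k$ with pairwise distinct poles $\xi_1,\dots,\xi_m\in\mathbb{C}\setminus\mathbb{R}$ and positive integer residues $n_1,\dots,n_m$. Then for every pole $\xi_k$, $k=1,\dots,m$, $$ |\mathrm{Im}\,\xi_k|\cdot\|\rho_n\|_{L^{\infty}(\mathbb{R})}\;\ge\; c\,\frac{(\ln n)^{1/n_k}+1}{(\ln n)^{1/n_k}-1}\cdot\frac{\ln\ln n}{\ln n}\;>\;2c\,\frac{n_k}{\ln n}. $$
   Context: A simple partial fraction (SPF) of order $n$ is the logarithmic derivative of an algebraic polynomial $Q(z)=\prod_{k=1}^m (z-\xi_k)^{n_k}$ of degree $n=\sum_{k=1}^m n_k$ with distinct complex roots $\xi_k$ and multiplicities $n_k\in\mathbb{N}$, i.e. $\rho_n(z)=Q'(z)/Q(z)=\sum_{k=1}^m \frac{n_k}{z-\xi_k}$. "Absolute constant" means that $c$ does not depend on $n$, $m$, the poles, or the residues. *)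

theory Defs
  imports "HOL-Probability.Essential_Supremum" "HOL-Computational_Algebra.Polynomial"
begin

definition spf :: "nat \<Rightarrow> (nat \<Rightarrow> complex) \<Rightarrow> (nat \<Rightarrow> nat) \<Rightarrow> complex \<Rightarrow> complex" where
  "spf m \<xi> \<nu> z = (\<Sum>k=1..m. of_nat (\<nu> k) / (z - \<xi> k))"

definition spf_poly :: "nat \<Rightarrow> (nat \<Rightarrow> complex) \<Rightarrow> (nat \<Rightarrow> nat) \<Rightarrow> complex poly" where
  "spf_poly m \<xi> \<nu> = (\<Prod>k=1..m. [:- \<xi> k, 1:] ^ \<nu> k)"

lemma degree_spf_poly: "degree (spf_poly m \<xi> \<nu>) = (\<Sum>k=1..m. \<nu> k)"
  unfolding spf_poly_def
  by (subst degree_prod_eq_sum_degree) (auto simp: degree_linear_power)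

lemma spf_eq_logderiv:
  assumes "\<And>k. k \<in> {1..m} \<Longrightarrow> z \<noteq> \<xi> k"
  shows "spf m \<xi> \<nu> z = poly (pderiv (spf_poly m \<xi> \<nu>)) z / poly (spf_poly m \<xi> \<nu>) z"
  using assms
proof (induction m)
  case 0
  then show ?case by (simp add: spf_def spf_poly_def)
next
  case (Suc m)
  define P where "P = spf_poly m \<xi> \<nu>"
  define L where "L = [:- \<xi> (Suc m), 1:] ^ \<nu> (Suc m)"
  have eq: "spf_poly (Suc m) \<xi> \<nu> = P * L"
    by (simp add: spf_poly_def P_def L_def)
  have ne: "z - \<xi> (Suc m) \<noteq> 0" and neP: "poly P z \<noteq> 0"
    using Suc.prems by (auto simp: P_def spf_poly_def poly_prod)
  have neL: "poly L z \<noteq> 0"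
    using ne by (auto simp: L_def)
  have L': "poly (pderiv L) z / poly L z = of_nat (\<nu> (Suc m)) / (z - \<xi> (Suc m))"
  proof (cases "\<nu> (Suc m)")
    case 0
    then show ?thesis by (simp add: L_def)
  next
    case (Suc j)
    have "pderiv L = smult (of_nat (Suc j)) ([:- \<xi> (Suc m), 1:] ^ j)"
      unfolding L_def Suc pderiv_power_Suc by (simp add: pderiv_pCons del: of_nat_Suc)
    then have "poly (pderiv L) z = of_nat (Suc j) * (z - \<xi> (Suc m)) ^ j"
      by (simp del: of_nat_Suc)
    moreover have "poly L z = (z - \<xi> (Suc m)) * (z - \<xi> (Suc m)) ^ j"
      unfolding L_def Suc poly_power by simp
    ultimately show ?thesis using ne Suc by (simp del: of_nat_Suc)
  qed
  have "spf (Suc m) \<xi> \<nu> z = spf m \<xi> \<nu> z + of_nat (\<nu> (Suc m)) / (z - \<xi> (Suc m))"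
    by (simp add: spf_def)
  also have "\<dots> = poly (pderiv P) z / poly P z + poly (pderiv L) z / poly L z"
    using Suc by (simp add: P_def L')
  also have "\<dots> = poly (pderiv (P * L)) z / poly (P * L) z"
    using neP neL by (simp add: pderiv_mult field_simps)
  finally show ?case by (simp only: eq)
qed

definition Linf_norm :: "(real \<Rightarrow> complex) \<Rightarrow> ereal" where
  "Linf_norm f = esssup lebesgue (\<lambda>x. ereal (cmod (f x)))"

end

theory Submission
  imports Defs "HOL-Complex_Analysis.Complex_Analysis"
begin

text \<open>
  Let \<open>M\<close> be the sup norm of \<open>\<rho>\<close> on the real line and \<open>L = ln n\<close>. Since \<open>coth x\<close> is at most
  \<open>1 + 1/x\<close>, it suffices to show that \<open>M \<bar>Im \<xi>\<bar>\<close> dominates both \<open>\<nu> / L\<close> and \<open>ln L / L\<close>.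

  Multiplicity: pair \<open>\<rho>\<close> with \<open>1/(s + iy) - 1/(s + iR)\<close>, \<open>R = n/M\<close>. By residues only the poles in the
  upper half-plane contribute, all with the same sign up to an error \<open>n/R\<close>, while the \<open>L\<^sup>1\<close> norm of the
  kernel is of order \<open>ln (R/y)\<close>. For \<open>y = \<bar>Im \<xi>\<bar>\<close> this gives \<open>\<nu>/y = O(M ln (n/(My)))\<close>.

  Double logarithm: it is enough to treat a pole \<open>ih\<close> nearest to the real line. On \<open>[-h, h]\<close> the polynomial
  \<open>Q\<close> is nearly constant, as \<open>\<bar>Q'/Q\<bar> \<le> M\<close>, yet \<open>Q(ih) = 0\<close>. The maximum principle for
  \<open>F = Q/Q(0) - 1\<close> on the square with bottom side \<open>[-h, h]\<close> and centre \<open>ih\<close> therefore forces \<open>F\<close> to be of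
  size at least a power of \<open>1/(Mh)\<close> somewhere on the square. On the other hand the growth of \<open>ln \<bar>Q\<bar>\<close> there
  is at most \<open>O(h)\<close> times the sum over the lower poles estimated in the first step, that is
  \<open>O(Mh ln (n/(Mh)))\<close>.
\<close>

section \<open>Integrals over [-T, T] and their limits\<close>

text \<open>Factoring out T gives Ln (T + c) = ln T + Ln (1 + c/T). The divergent
  \<open>ln T\<close> then cancels in differences of logarithms.\<close>

lemma tendsto_Ln_add_of_real:
  fixes c :: complex
  shows "((\<lambda>T::real. Ln (of_real T + c) - of_real (ln T)) \<longlongrightarrow> 0) at_top"
proof -
  have "((\<lambda>T::real. c * of_real (inverse T)) \<longlongrightarrow> c * of_real 0) at_top"
    by (intro tendsto_mult tendsto_const tendsto_of_real tendsto_inverse_0_at_top filterlim_ident)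
  then have "((\<lambda>T::real. 1 + c * of_real (inverse T)) \<longlongrightarrow> 1 + c * of_real 0) at_top"
    by (rule tendsto_add[OF tendsto_const])
  then have "((\<lambda>T::real. Ln (1 + c * of_real (inverse T))) \<longlongrightarrow> Ln 1) at_top"
    by (intro tendsto_Ln) auto
  moreover have "\<forall>\<^sub>F T::real in at_top. Ln (1 + c * of_real (inverse T)) = Ln (of_real T + c) - of_real (ln T)"
    using eventually_gt_at_top[of "cmod c"]
  proof eventually_elim
    case (elim T)
    have T: "T > 0" using elim norm_ge_zero[of c] by linarith
    have eq: "of_real T + c = of_real T * (1 + c * of_real (inverse T))"
      using T by (simp add: field_simps)
    have "of_real T + c \<noteq> 0"
    proof
      assume "of_real T + c = 0"
      then have "c = - of_real T" by (simp add: add_eq_0_iff)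
      then show False using elim T by simp
    qed
    then have "1 + c * of_real (inverse T) \<noteq> 0" using eq by auto
    then show ?case
      unfolding eq using T by (subst Ln_times_of_real) (auto simp: Ln_of_real)
  qed
  ultimately show ?thesis by (simp add: tendsto_cong)
qed

text \<open>A residue computation through an explicit antiderivative. For distinct poles the
  principal branch is smooth along the real line because \<open>s - a\<close> and
  \<open>s - b\<close> are never real. The limit comes only from the jumps of \<open>Ln\<close>
  under negation, which cancel unless \<open>a\<close> and \<open>b\<close> lie on opposite sides of
  the line.\<close>

lemma has_integral_inverse_two_poles:
  fixes a b :: complex
  assumes "Im a \<noteq> 0" "Im b < 0"
  shows "\<exists>J. (\<forall>T::real>0. ((\<lambda>s. 1 / ((of_real s - a) * (of_real s - b))) has_integral J T) {-T..T})
    \<and> (J \<longlongrightarrow> (if Im a > 0 then 2 * pi * \<i> / (a - b) else 0)) at_top"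
proof (cases "a = b")
  case True
  define F where "F = (\<lambda>s::real. - 1 / (of_real s - a))"
  have ne: "of_real s \<noteq> a" for s :: real using assms by auto
  have "((\<lambda>s. 1 / ((of_real s - a) * (of_real s - b))) has_integral (F T - F (-T))) {-T..T}" if "T > 0" for T :: real
  proof (rule fundamental_theorem_of_calculus)
    show "(F has_vector_derivative 1 / ((of_real x - a) * (of_real x - b))) (at x within {-T..T})" for x
      unfolding F_def
      apply (rule has_vector_derivative_real_field)
      apply (rule derivative_eq_intros refl)+
      using ne[of x] True by (auto simp: field_simps)
  qed (use that in auto)
  moreover have "((\<lambda>T::real. F T - F (-T)) \<longlongrightarrow> 0 - 0) at_top"
  proof (rule tendsto_diff)
    have *: "((\<lambda>T::real. c * (1 / (of_real T - d :: complex))) \<longlongrightarrow> c * 0) at_top" for c d :: complex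
    proof (rule tendsto_mult[OF tendsto_const])
      have "filterlim (\<lambda>T::real. of_real T - d :: complex) at_infinity at_top"
        using tendsto_add_filterlim_at_infinity'[OF filterlim_of_real_at_infinity, of "\<lambda>_. - d" "- d"]
        by simp
      then show "((\<lambda>T::real. 1 / (of_real T - d)) \<longlongrightarrow> 0) at_top"
        by (intro tendsto_divide_0[OF tendsto_const])
    qed
    show "(F \<longlongrightarrow> 0) at_top" using *[of "-1" a] by (simp add: F_def)
    have "- of_real x - a = - (of_real x + a)" for x :: real by simp
    then show "((\<lambda>T. F (-T)) \<longlongrightarrow> 0) at_top" using *[of 1 "-a"] by (simp only: F_def of_real_minus divide_minus_left divide_minus_right minus_minus diff_minus_eq_add) simp
  qed
  ultimately show ?thesis using True assms by (intro exI[of _ "\<lambda>T. F T - F (-T)"]) auto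
next
  case False
  define F where "F = (\<lambda>s::real. (Ln (of_real s - a) - Ln (of_real s - b)) / (a - b))"
  have nea: "of_real s - a \<notin> \<real>\<^sub>\<le>\<^sub>0" and neb: "of_real s - b \<notin> \<real>\<^sub>\<le>\<^sub>0" for s :: real
    using assms by (auto simp: complex_nonpos_Reals_iff)
  have "((\<lambda>s. 1 / ((of_real s - a) * (of_real s - b))) has_integral (F T - F (-T))) {-T..T}" if "T > 0" for T :: real
  proof (rule fundamental_theorem_of_calculus)
    show "(F has_vector_derivative 1 / ((of_real x - a) * (of_real x - b))) (at x within {-T..T})" for x
    proof -
      have "of_real x - a \<noteq> 0" "of_real x - b \<noteq> 0" using nea[of x] neb[of x] by auto
      then have "(1 / (of_real x - a) - 1 / (of_real x - b)) / (a - b) = 1 / ((of_real x - a) * (of_real x - b))"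
        using False by (simp add: divide_simps)
      then show ?thesis unfolding F_def
        apply (intro has_vector_derivative_real_field)
        apply (rule derivative_eq_intros refl nea neb)+
        using False by (auto simp: inverse_eq_divide)
    qed
  qed (use that in auto)
  moreover have "((\<lambda>T::real. F T - F (-T)) \<longlongrightarrow> (if Im a > 0 then 2 * pi * \<i> / (a - b) else 0)) at_top"
  proof -
    \<comment> \<open>The half-plane of \<open>c\<close> decides the sign of the jump, so
      \<open>a\<close> above and \<open>b\<close> below together contribute 2 pi i, the constant
      \<open>d\<close>.\<close>
    have Lm: "Ln (of_real (-T) - c) = Ln (of_real T + c) - (if Im c > 0 then \<i> * pi else - \<i> * pi)"
      if "Im c \<noteq> 0" for c :: complex and T :: real
    proof -
      have "of_real T + c \<noteq> 0" using that by (auto simp: complex_eq_iff)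
      from Ln_minus[OF this] show ?thesis using that by (auto simp: )
    qed
    define d where "d = (if Im a > 0 then 2 * pi * \<i> else 0)"
    define D where "D = (\<lambda>c (T::real). Ln (of_real T + c) - of_real (ln T))"
    have "((\<lambda>T. (D (- a) T - D (- b) T - (D a T - D b T) + d) / (a - b)) \<longlongrightarrow> (0 - 0 - (0 - 0) + d) / (a - b)) at_top"
      unfolding D_def by (intro tendsto_intros tendsto_Ln_add_of_real) (use False in auto)
    moreover have "(D (- a) T - D (- b) T - (D a T - D b T) + d) / (a - b) = F T - F (- T)" for T
    proof -
      have "Ln (of_real (- T) - a) - Ln (of_real (- T) - b) = Ln (of_real T + a) - Ln (of_real T + b) - d"
        using assms by (subst (1 2) Lm) (auto simp: d_def)
      then show ?thesis unfolding F_def D_def diff_divide_distrib[symmetric] by simp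
    qed
    ultimately show ?thesis by (simp add: d_def if_distrib[of "\<lambda>x. x / (a - b)"] cong: if_cong)
  qed
  ultimately show ?thesis by (intro exI[of _ "\<lambda>T. F T - F (-T)"]) blast
qed

text \<open>The bound is uniform in \<open>T\<close>: on each half-line the antiderivative
  \<open>ln (s + y) - ln (s + R)\<close> is nonpositive at \<open>T\<close>, so only its value at 0
  counts.\<close>

lemma has_integral_log_majorant:
  fixes y R T :: real
  assumes "0 < y" "y < R" "0 < T"
  obtains I where "((\<lambda>s. 1 / (\<bar>s\<bar> + y) - 1 / (\<bar>s\<bar> + R)) has_integral I) {-T..T}" "I \<le> 2 * ln (R / y)"
proof -
  have 1: "((\<lambda>s. 1 / (\<bar>s\<bar> + y) - 1 / (\<bar>s\<bar> + R)) has_integral ((ln (T + y) - ln (T + R)) - (ln (0 + y) - ln (0 + R)))) {0..T}"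
  proof (rule fundamental_theorem_of_calculus)
    fix x assume x: "x \<in> {0..T}"
    show "((\<lambda>s. ln (s + y) - ln (s + R)) has_vector_derivative 1 / (\<bar>x\<bar> + y) - 1 / (\<bar>x\<bar> + R)) (at x within {0..T})"
      unfolding has_real_derivative_iff_has_vector_derivative[symmetric]
      using x assms by (auto intro!: derivative_eq_intros simp: field_simps)
  qed (use assms in auto)
  have 2: "((\<lambda>s. 1 / (\<bar>s\<bar> + y) - 1 / (\<bar>s\<bar> + R)) has_integral ((ln (T + y) - ln (T + R)) - (ln (0 + y) - ln (0 + R)))) {-T..0}"
    using has_integral_reflect_lemma_real[OF 1] by simp
  have "ln (T + y) - ln (T + R) \<le> 0" using assms by simp
  moreover have "ln (R / y) = ln R - ln y" using assms by (simp add: ln_div)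
  ultimately show ?thesis
    using has_integral_combine[OF _ _ 2 1] assms by (intro that) auto
qed

section \<open>The kernel estimate for the poles in one half-plane\<close>

lemma spf_translate: "spf m (\<lambda>k. \<xi> k - a) \<nu> z = spf m \<xi> \<nu> (z + a)"
  by (simp add: spf_def algebra_simps)

text \<open>Conjugating the poles, like shifting them by a real number, keeps a bound on the real
  line. A chosen pole may thus be assumed to lie on the positive imaginary axis.\<close>

lemma spf_cnj: "spf m (\<lambda>k. cnj (\<xi> k)) \<nu> (of_real x) = cnj (spf m \<xi> \<nu> (of_real x))"
  by (simp add: spf_def)

text \<open>Each denominator has modulus at least (|s| + r)/sqrt 2, for r = y and r = R; the two
  roots multiply to the factor 2. The majorant has an elementary antiderivative.\<close>

lemma norm_kernel_le:
  fixes s y R :: real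
  assumes "0 < y" "y < R"
  shows "cmod (1 / (of_real s + \<i> * of_real y) - 1 / (of_real s + \<i> * of_real R))
         \<le> 2 * (1 / (\<bar>s\<bar> + y) - 1 / (\<bar>s\<bar> + R))"
proof -
  define A where "A = of_real s + \<i> * complex_of_real y"
  define B where "B = of_real s + \<i> * complex_of_real R"
  have ne: "A \<noteq> 0" "B \<noteq> 0" using assms by (auto simp: A_def B_def complex_eq_iff)
  have sq: "(\<bar>s\<bar> + r)\<^sup>2 \<le> 2 * (cmod (of_real s + \<i> * complex_of_real r))\<^sup>2" for r
  proof -
    have "0 \<le> (\<bar>s\<bar> - r)\<^sup>2" by simp
    then have "(\<bar>s\<bar> + r)\<^sup>2 \<le> 2 * (\<bar>s\<bar>\<^sup>2 + r\<^sup>2)" by (simp add: power2_eq_square algebra_simps)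
    then show ?thesis by (simp add: cmod_power2)
  qed
  have "((\<bar>s\<bar> + y) * (\<bar>s\<bar> + R))\<^sup>2 \<le> (2 * (cmod A)\<^sup>2) * (2 * (cmod B)\<^sup>2)"
    unfolding power_mult_distrib A_def B_def by (intro mult_mono sq) auto
  also have "\<dots> = (2 * (cmod A * cmod B))\<^sup>2" by (simp add: power_mult_distrib)
  finally have AB: "(\<bar>s\<bar> + y) * (\<bar>s\<bar> + R) \<le> 2 * (cmod A * cmod B)"
    by (rule power2_le_imp_le) auto
  have "1 / A - 1 / B = (\<i> * of_real (R - y)) / (A * B)"
    using ne by (simp add: field_simps) (simp add: A_def B_def algebra_simps)
  then have "cmod (1 / A - 1 / B) = (R - y) / (cmod A * cmod B)"
    using assms by (simp add: norm_divide norm_mult del: of_real_diff)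
  also have "\<dots> \<le> (R - y) / (((\<bar>s\<bar> + y) * (\<bar>s\<bar> + R)) / 2)"
    using assms AB ne by (intro divide_left_mono mult_pos_pos) auto
  also have "\<dots> = 2 * (1 / (\<bar>s\<bar> + y) - 1 / (\<bar>s\<bar> + R))"
    using assms by (simp add: field_simps)
  finally show ?thesis by (simp add: A_def B_def)
qed

text \<open>The kernel \<open>g\<close> has both poles in the lower half-plane, so lower poles of
  the fraction integrate to 0 in the limit and an upper pole contributes 2 pi i times its
  multiplicity times \<open>g\<close> there. The summand is minus the imaginary part of 1/(xi + iy);
  the second half of \<open>g\<close> costs at most 1/R per unit of multiplicity.\<close>

lemma upper_poles_sum_le:
  fixes \<xi> :: "nat \<Rightarrow> complex" and M y R :: real
  assumes nonreal: "\<And>k. k \<in> {1..m} \<Longrightarrow> Im (\<xi> k) \<noteq> 0"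
    and bound: "\<And>x::real. cmod (spf m \<xi> \<nu> (of_real x)) \<le> M"
    and yR: "0 < y" "y < R"
  shows "(\<Sum>k | k \<in> {1..m} \<and> Im (\<xi> k) > 0. \<nu> k * ((Im (\<xi> k) + y) / ((Re (\<xi> k))\<^sup>2 + (Im (\<xi> k) + y)\<^sup>2)))
         \<le> M * ln (R / y) + real (\<Sum>k=1..m. \<nu> k) / R"
proof -
  define a b where "a = - (\<i> * complex_of_real y)" and "b = - (\<i> * complex_of_real R)"
  define g where "g = (\<lambda>s::real. 1 / (of_real s - a) - 1 / (of_real s - b))"
  define U where "U = {k \<in> {1..m}. Im (\<xi> k) > 0}"
  define lim where "lim = (\<lambda>c k. if Im (\<xi> k) > 0 then 2 * pi * \<i> / (\<xi> k - c) else 0)"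
  have M0: "M \<ge> 0" using bound[of 0] norm_ge_zero order_trans by blast
  define P where "P = (\<lambda>k c J. (\<forall>T>0. ((\<lambda>s::real. 1 / ((of_real s - \<xi> k) * (of_real s - c))) has_integral J T) {-T..T})
             \<and> (J \<longlongrightarrow> lim c k) at_top)"
  \<comment> \<open>The integrals are known only existentially; choosing them as one function of
    pole and kernel point lets them be summed over \<open>k\<close>.\<close>
  define J where "J = (\<lambda>k c. SOME j. P k c j)"
  have "P k c (J k c)" if "k \<in> {1..m}" "c \<in> {a, b}" for k c
    unfolding J_def
  proof (rule someI_ex[of "P k c"])
    have "Im c < 0" using yR that(2) by (auto simp: a_def b_def)
    from has_integral_inverse_two_poles[OF nonreal[OF that(1)] this]
    show "\<exists>j. P k c j" unfolding P_def lim_def .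
  qed
  then have J: "\<And>k c T. k \<in> {1..m} \<Longrightarrow> c \<in> {a, b} \<Longrightarrow> T > 0 \<Longrightarrow>
            ((\<lambda>s::real. 1 / ((of_real s - \<xi> k) * (of_real s - c))) has_integral J k c T) {-T..T}"
    and Jlim: "\<And>k c. k \<in> {1..m} \<Longrightarrow> c \<in> {a, b} \<Longrightarrow> (J k c \<longlongrightarrow> lim c k) at_top"
    unfolding P_def by auto
  define S where "S = (\<lambda>T. \<Sum>k=1..m. of_nat (\<nu> k) * (J k a T - J k b T))"
  have int: "((\<lambda>s::real. spf m \<xi> \<nu> (of_real s) * g s) has_integral S T) {-T..T}" if "T > 0" for T
  proof -
    have "((\<lambda>s::real. \<Sum>k=1..m. of_nat (\<nu> k) * (1 / ((of_real s - \<xi> k) * (of_real s - a)) - 1 / ((of_real s - \<xi> k) * (of_real s - b))))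
       has_integral S T) {-T..T}"
      unfolding S_def using that
      by (intro has_integral_sum has_integral_mult_right has_integral_diff J) auto
    also have "(\<lambda>s::real. \<Sum>k=1..m. of_nat (\<nu> k) * (1 / ((of_real s - \<xi> k) * (of_real s - a)) - 1 / ((of_real s - \<xi> k) * (of_real s - b))))
       = (\<lambda>s. spf m \<xi> \<nu> (of_real s) * g s)"
      unfolding spf_def g_def sum_distrib_right by (intro ext sum.cong) (simp_all add: right_diff_distrib)
    finally show ?thesis .
  qed
  \<comment> \<open>The 4 is the kernel factor 2 times the 2 of the majorant integral; later it is
    absorbed by 2 pi >= 4.\<close>
  have Sle: "norm (S T) \<le> 4 * M * ln (R / y)" if T: "T > 0" for T
  proof -
    obtain I where I: "((\<lambda>s. 1 / (\<bar>s\<bar> + y) - 1 / (\<bar>s\<bar> + R)) has_integral I) {-T..T}" "I \<le> 2 * ln (R / y)"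
      using has_integral_log_majorant[OF yR T] by blast
    have "norm (spf m \<xi> \<nu> (of_real s) * g s) \<le> M * (2 * (1 / (\<bar>s\<bar> + y) - 1 / (\<bar>s\<bar> + R)))" for s
      unfolding norm_mult using norm_kernel_le[OF yR, of s] bound[of s] M0
      by (intro mult_mono) (auto simp: g_def a_def b_def)
    then have "norm (integral {-T..T} (\<lambda>s. spf m \<xi> \<nu> (of_real s) * g s))
        \<le> integral {-T..T} (\<lambda>s. M * (2 * (1 / (\<bar>s\<bar> + y) - 1 / (\<bar>s\<bar> + R))))"
      using int[OF T] I(1)
      by (intro integral_norm_bound_integral integrable_on_mult_right) (auto simp: integrable_on_def)
    also have "\<dots> = M * (2 * I)"
      by (intro integral_unique has_integral_mult_right I)
    also have "\<dots> \<le> M * (2 * (2 * ln (R / y)))"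
      using I(2) M0 by (intro mult_left_mono) auto
    finally show ?thesis using integral_unique[OF int[OF T]] by simp
  qed
  define W where "W = (\<Sum>k\<in>U. of_nat (\<nu> k) * (1 / (\<xi> k - a) - 1 / (\<xi> k - b)))"
  have "(\<Sum>k=1..m. of_nat (\<nu> k) * (lim a k - lim b k)) = (\<Sum>k\<in>U. of_nat (\<nu> k) * (lim a k - lim b k))"
    unfolding U_def by (rule sum.mono_neutral_right) (auto simp: lim_def)
  also have "\<dots> = 2 * pi * \<i> * W"
    unfolding W_def sum_distrib_left by (rule sum.cong) (auto simp: U_def lim_def algebra_simps)
  finally have Wlim: "(\<Sum>k=1..m. of_nat (\<nu> k) * (lim a k - lim b k)) = 2 * pi * \<i> * W" .
  have "(S \<longlongrightarrow> 2 * pi * \<i> * W) at_top"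
    unfolding S_def Wlim[symmetric] by (intro tendsto_intros Jlim) auto
  moreover have "\<forall>\<^sub>F T in at_top. norm (S T) \<le> 4 * M * ln (R / y)"
    using eventually_gt_at_top[of 0] by eventually_elim (rule Sle)
  ultimately have "norm (2 * pi * \<i> * W) \<le> 4 * M * ln (R / y)"
    by (rule Lim_norm_ubound[OF trivial_limit_at_top_linorder])
  then have "(2 * pi) * norm W \<le> 4 * M * ln (R / y)" by (simp add: norm_mult)
  moreover have "4 * norm W \<le> (2 * pi) * norm W"
    using pi_ge_two by (intro mult_right_mono) auto
  ultimately have "norm W \<le> M * ln (R / y)" by simp
  then have W: "- Im W \<le> M * ln (R / y)" using abs_Im_le_cmod[of W] by linarith
  have "\<nu> k * ((Im (\<xi> k) + y) / ((Re (\<xi> k))\<^sup>2 + (Im (\<xi> k) + y)\<^sup>2)) - \<nu> k / R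
        \<le> - Im (of_nat (\<nu> k) * (1 / (\<xi> k - a) - 1 / (\<xi> k - b)))" if "k \<in> U" for k
  proof -
    define u v where "u = Re (\<xi> k)" and "v = Im (\<xi> k)"
    have v: "v > 0" using that by (auto simp: U_def v_def)
    have "(v + R) * R \<le> (v + R) * (v + R)" using v yR by (intro mult_left_mono) auto
    then have "(v + R) * R \<le> u\<^sup>2 + (v + R)\<^sup>2"
      using zero_le_power2[of u] unfolding power2_eq_square[of "v + R"] by linarith
    moreover have "u\<^sup>2 + (v + R)\<^sup>2 > 0" using v yR by (simp add: sum_power2_gt_zero_iff)
    ultimately have "(v + R) / (u\<^sup>2 + (v + R)\<^sup>2) \<le> 1 / R"
      using yR by (simp add: field_simps)
    moreover have "Im (1 / (\<xi> k - (- (\<i> * of_real r)))) = - ((v + r) / (u\<^sup>2 + (v + r)\<^sup>2))" for r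
      by (simp add: u_def v_def Im_divide minus_divide_left)
    ultimately have "(v + y) / (u\<^sup>2 + (v + y)\<^sup>2) - 1 / R \<le> - Im (1 / (\<xi> k - a) - 1 / (\<xi> k - b))"
      by (simp only: a_def b_def minus_complex.sel)
    then have "\<nu> k * ((v + y) / (u\<^sup>2 + (v + y)\<^sup>2) - 1 / R) \<le> \<nu> k * - Im (1 / (\<xi> k - a) - 1 / (\<xi> k - b))"
      by (intro mult_left_mono) auto
    moreover define Z where "Z = 1 / (\<xi> k - a) - 1 / (\<xi> k - b)"
    ultimately show ?thesis unfolding Z_def[symmetric] by (simp add: u_def v_def right_diff_distrib)
  qed
  then have "(\<Sum>k\<in>U. \<nu> k * ((Im (\<xi> k) + y) / ((Re (\<xi> k))\<^sup>2 + (Im (\<xi> k) + y)\<^sup>2)) - \<nu> k / R) \<le> - Im W"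
    unfolding W_def Im_sum sum_negf[symmetric] by (rule sum_mono)
  moreover have "(\<Sum>k\<in>U. \<nu> k / R) \<le> (\<Sum>k=1..m. \<nu> k / R)"
    using yR by (intro sum_mono2) (auto simp: U_def)
  ultimately show ?thesis using W by (simp add: sum_subtractf sum_divide_distrib[symmetric] U_def)
qed

section \<open>Growth of Q on the real line and on the square\<close>

text \<open>Integrating Q'/Q from 0 to \<open>x\<close> puts Q(x)/Q(0) in exponential form. This
  form gives both closeness to 1 and a bound on the modulus over a short interval.\<close>

lemma spf_poly_on_reals:
  assumes nonreal: "\<And>k. k \<in> {1..m} \<Longrightarrow> Im (\<xi> k) \<noteq> 0"
    and bound: "\<And>x::real. cmod (spf m \<xi> \<nu> (of_real x)) \<le> M"
  obtains h where "poly (spf_poly m \<xi> \<nu>) (of_real x) = poly (spf_poly m \<xi> \<nu>) 0 * exp h" "cmod h \<le> M * \<bar>x\<bar>"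
proof -
  \<comment> \<open>a primitive of \<open>\<rho>\<close> along the real line: no logarithm crosses its branch cut there\<close>
  define H where "H = (\<lambda>z. \<Sum>k=1..m. of_nat (\<nu> k) * (Ln (z - \<xi> k) - Ln (- \<xi> k)))"
  have "norm (H (of_real x) - H 0) \<le> M * norm (of_real x - 0 :: complex)"
  proof (rule field_differentiable_bound)
    show "convex \<real>" by (simp add: convex_Reals)
    show "(H has_field_derivative spf m \<xi> \<nu> z) (at z within \<real>)" if "z \<in> \<real>" for z
    proof -
      have "z - \<xi> k \<notin> \<real>\<^sub>\<le>\<^sub>0" if "k \<in> {1..m}" for k
        using nonreal[OF that] \<open>z \<in> \<real>\<close> by (auto simp: complex_nonpos_Reals_iff complex_is_Real_iff)
      then show ?thesis unfolding H_def spf_def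
        by (intro DERIV_sum) (auto intro!: derivative_eq_intros simp: divide_inverse mult.commute)
    qed
    show "cmod (spf m \<xi> \<nu> z) \<le> M" if "z \<in> \<real>" for z
      using bound that by (auto elim!: Reals_cases)
  qed auto
  moreover have "H 0 = 0" by (simp add: H_def)
  ultimately have "norm (H (of_real x)) \<le> M * \<bar>x\<bar>" by simp
  moreover have "poly (spf_poly m \<xi> \<nu>) (of_real x) = poly (spf_poly m \<xi> \<nu>) 0 * exp (H (of_real x))"
  proof -
    have "exp (of_nat (\<nu> k) * (Ln (of_real x - \<xi> k) - Ln (- \<xi> k))) = ((of_real x - \<xi> k) / (- \<xi> k)) ^ \<nu> k"
      if "k \<in> {1..m}" for k
    proof -
      have "of_real x - \<xi> k \<noteq> 0" "- \<xi> k \<noteq> 0" using nonreal[OF that] by (auto simp: complex_eq_iff)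
      then show ?thesis by (simp add: exp_of_nat_mult exp_diff)
    qed
    then have "exp (H (of_real x)) = (\<Prod>k=1..m. ((of_real x - \<xi> k) / (- \<xi> k)) ^ \<nu> k)"
      unfolding H_def by (subst exp_sum) auto
    moreover have "(- \<xi> k) ^ \<nu> k * ((of_real x - \<xi> k) / (- \<xi> k)) ^ \<nu> k = (of_real x - \<xi> k) ^ \<nu> k"
      if "k \<in> {1..m}" for k
      using nonreal[OF that] by (auto simp: power_mult_distrib[symmetric])
    then have "(\<Prod>k=1..m. (- \<xi> k) ^ \<nu> k * ((of_real x - \<xi> k) / (- \<xi> k)) ^ \<nu> k) = (\<Prod>k=1..m. (of_real x - \<xi> k) ^ \<nu> k)"
      by (rule prod.cong[OF refl])
    ultimately show ?thesis
      by (simp only: spf_poly_def poly_prod prod.distrib) (simp add: poly_prod prod.distrib)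
  qed
  ultimately show ?thesis by (rule that[rotated])
qed

text \<open>Compare factor by factor. An upper pole has height at least h >= t/2, so moving up by
  \<open>t\<close> does not increase the distance to it. For a lower pole the squared distance grows
  by at most 8h times its depth, and 1 + 2q <= exp (2q).\<close>

lemma spf_poly_vertical_growth:
  assumes h: "h > 0" and far: "\<And>k. k \<in> {1..m} \<Longrightarrow> h \<le> \<bar>Im (\<xi> k)\<bar>" and t: "0 \<le> t" "t \<le> 2 * h"
  shows "cmod (poly (spf_poly m \<xi> \<nu>) (Complex x t)) \<le> cmod (poly (spf_poly m \<xi> \<nu>) (of_real x)) *
    exp (4 * h * (\<Sum>k | k \<in> {1..m} \<and> Im (\<xi> k) < 0. \<nu> k * (\<bar>Im (\<xi> k)\<bar> / (cmod (of_real x - \<xi> k))\<^sup>2)))"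
proof -
  define q where "q = (\<lambda>k. if Im (\<xi> k) < 0 then 4 * h * (\<bar>Im (\<xi> k)\<bar> / (cmod (of_real x - \<xi> k))\<^sup>2) else 0)"
  have fac: "cmod (Complex x t - \<xi> k) \<le> cmod (of_real x - \<xi> k) * exp (q k)" if k: "k \<in> {1..m}" for k
  proof -
    define u v where "u = x - Re (\<xi> k)" and "v = Im (\<xi> k)"
    have v: "h \<le> \<bar>v\<bar>" using far[OF k] by (simp add: v_def)
    have n1: "(cmod (Complex x t - \<xi> k))\<^sup>2 = u\<^sup>2 + (t - v)\<^sup>2" by (simp add: cmod_power2 u_def v_def)
    have n2: "(cmod (of_real x - \<xi> k))\<^sup>2 = u\<^sup>2 + v\<^sup>2" by (simp add: cmod_power2 u_def v_def)
    have "(cmod (Complex x t - \<xi> k))\<^sup>2 \<le> (cmod (of_real x - \<xi> k) * exp (q k))\<^sup>2"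
    proof (cases "v < 0")
      case False
      have "t * t \<le> t * (2 * v)" using t v False by (intro mult_left_mono) auto
      then have "u\<^sup>2 + (t - v)\<^sup>2 \<le> u\<^sup>2 + v\<^sup>2" by (simp add: power2_eq_square algebra_simps)
      then show ?thesis using False by (simp add: q_def v_def[symmetric] n1 n2)
    next
      case True
      have pos: "u\<^sup>2 + v\<^sup>2 > 0" using True by (simp add: sum_power2_gt_zero_iff)
      have "t * t \<le> (2 * h) * (2 * - v)" using t v True by (intro mult_mono) auto
      then have 1: "t * t \<le> - 4 * (h * v)" by simp
      have "t * - v \<le> (2 * h) * - v" using t True by (intro mult_right_mono) auto
      then have 2: "- (t * v) \<le> - 2 * (h * v)" by simp
      have 3: "(t - v)\<^sup>2 = t * t - 2 * (t * v) + v\<^sup>2" by (simp add: power2_eq_square algebra_simps)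
      have 4: "8 * h * \<bar>v\<bar> = - 8 * (h * v)" using True by simp
      have "u\<^sup>2 + (t - v)\<^sup>2 \<le> u\<^sup>2 + v\<^sup>2 + 8 * h * \<bar>v\<bar>"
        using 1 2 unfolding 3 4 by linarith
      also have "\<dots> = (u\<^sup>2 + v\<^sup>2) * (1 + 2 * q k)"
        using True pos by (simp add: q_def v_def[symmetric] n2 field_simps)
      also have "\<dots> \<le> (u\<^sup>2 + v\<^sup>2) * exp (2 * q k)"
        using pos by (intro mult_left_mono exp_ge_add_one_self) auto
      also have "\<dots> = (cmod (of_real x - \<xi> k) * exp (q k))\<^sup>2"
        by (simp add: power_mult_distrib n2 exp_double)
      finally show ?thesis by (simp add: n1)
    qed
    then show ?thesis by (rule power2_le_imp_le) auto
  qed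
  have "cmod (poly (spf_poly m \<xi> \<nu>) (Complex x t)) = (\<Prod>k=1..m. cmod (Complex x t - \<xi> k) ^ \<nu> k)"
    by (simp add: spf_poly_def poly_prod prod_norm[symmetric] norm_power)
  also have "\<dots> \<le> (\<Prod>k=1..m. (cmod (of_real x - \<xi> k) * exp (q k)) ^ \<nu> k)"
    by (intro prod_mono conjI power_mono fac) auto
  also have "\<dots> = cmod (poly (spf_poly m \<xi> \<nu>) (of_real x)) * exp (\<Sum>k=1..m. \<nu> k * q k)"
    by (simp add: spf_poly_def poly_prod prod_norm[symmetric] norm_power power_mult_distrib prod.distrib exp_sum exp_of_nat_mult)
  also have "(\<Sum>k=1..m. \<nu> k * q k) = (\<Sum>k | k \<in> {1..m} \<and> Im (\<xi> k) < 0. \<nu> k * q k)"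
    by (rule sum.mono_neutral_right) (auto simp: q_def)
  also have "\<dots> = 4 * h * (\<Sum>k | k \<in> {1..m} \<and> Im (\<xi> k) < 0. \<nu> k * (\<bar>Im (\<xi> k)\<bar> / (cmod (of_real x - \<xi> k))\<^sup>2))"
    unfolding sum_distrib_left by (rule sum.cong) (auto simp: q_def)
  finally show ?thesis .
qed

text \<open>The product of \<open>F\<close> over the four rotations about the centre is small on the whole boundary, because
  one of the four factors is always evaluated on the bottom side.\<close>

lemma norm_at_square_center_le:
  fixes F :: "complex \<Rightarrow> complex"
  assumes hol: "F holomorphic_on UNIV" and h: "h > 0"
    and bottom: "\<And>x. \<bar>x\<bar> \<le> h \<Longrightarrow> cmod (F (of_real x)) \<le> e"
    and square: "\<And>x t. \<bar>x\<bar> \<le> h \<Longrightarrow> 0 \<le> t \<Longrightarrow> t \<le> 2 * h \<Longrightarrow> cmod (F (Complex x t)) \<le> B"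
  shows "cmod (F (Complex 0 h)) ^ 4 \<le> e * B ^ 3"
proof -
  define c where "c = Complex 0 h"
  define S where "S = cbox (Complex (-h) (-h)) (Complex h h)"
  define G where "G = (\<lambda>w. F (c + w) * F (c + \<i> * w) * F (c - w) * F (c - \<i> * w))"
  have holG: "G holomorphic_on A" for A
    unfolding G_def by (intro holomorphic_intros holomorphic_on_compose_gen[OF _ hol, unfolded o_def]) auto
  have B0: "0 \<le> B" using h by (intro order_trans[OF norm_ge_zero square[of 0 0]]) auto
  have e0: "0 \<le> e" using h by (intro order_trans[OF norm_ge_zero bottom[of 0]]) auto
  have "cmod (G 0) \<le> e * B ^ 3"
  proof (rule maximum_modulus_frontier[of G S])
    show "G holomorphic_on interior S" by (rule holG)
    show "continuous_on (closure S) G" by (intro holomorphic_on_imp_continuous_on holG)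
    show "bounded S" by (simp add: S_def)
    show "0 \<in> S" using h by (simp add: S_def in_cbox_complex_iff)
    fix z assume z: "z \<in> frontier S"
    define u v where "u = Re z" and "v = Im z"
    have uv: "\<bar>u\<bar> \<le> h" "\<bar>v\<bar> \<le> h" "\<bar>u\<bar> = h \<or> \<bar>v\<bar> = h"
      using z by (auto simp: S_def frontier_cbox in_cbox_complex_iff in_box_complex_iff u_def v_def)
    define f1 f2 f3 f4 where "f1 = cmod (F (c + z))" and "f2 = cmod (F (c + \<i> * z))"
      and "f3 = cmod (F (c - z))" and "f4 = cmod (F (c - \<i> * z))"
    have eqs: "c + z = Complex u (h + v)" "c + \<i> * z = Complex (- v) (h + u)"
      "c - z = Complex (- u) (h - v)" "c - \<i> * z = Complex v (h - u)"
      by (auto simp: c_def u_def v_def complex_eq_iff)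
    have fB: "f1 \<le> B" "f2 \<le> B" "f3 \<le> B" "f4 \<le> B"
      unfolding f1_def f2_def f3_def f4_def eqs using uv by (auto intro!: square)
    have f0: "0 \<le> f1" "0 \<le> f2" "0 \<le> f3" "0 \<le> f4"
      by (auto simp: f1_def f2_def f3_def f4_def)
    have bot: "cmod (F (Complex x 0)) \<le> e" if "\<bar>x\<bar> \<le> h" for x
      using bottom[OF that] by (simp add: complex_of_real_def)
    \<comment> \<open>The four sides of the frontier correspond in this order to the factors
      \<open>f1\<close>, \<open>f2\<close>, \<open>f3\<close>, \<open>f4\<close> that are evaluated
      on the bottom side.\<close>
    have "v = - h \<or> u = - h \<or> v = h \<or> u = h" using uv by auto
    then have "f1 \<le> e \<or> f2 \<le> e \<or> f3 \<le> e \<or> f4 \<le> e"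
      unfolding f1_def f2_def f3_def f4_def eqs using uv bot by force
    moreover have "p * q * r * s \<le> e * B ^ 3" if "p \<le> e" "q \<le> B" "r \<le> B" "s \<le> B" "0 \<le> p" "0 \<le> q" "0 \<le> r" "0 \<le> s" for p q r s
    proof -
      have "p * q * r * s \<le> e * B * B * B"
        using that B0 e0 by (intro mult_mono) auto
      then show ?thesis by (simp add: power3_eq_cube mult.assoc)
    qed
    from this[of f1 f2 f3 f4] this[of f2 f1 f3 f4] this[of f3 f1 f2 f4] this[of f4 f1 f2 f3]
    have "f1 \<le> e \<Longrightarrow> f1 * f2 * f3 * f4 \<le> e * B ^ 3" "f2 \<le> e \<Longrightarrow> f1 * f2 * f3 * f4 \<le> e * B ^ 3"
      "f3 \<le> e \<Longrightarrow> f1 * f2 * f3 * f4 \<le> e * B ^ 3" "f4 \<le> e \<Longrightarrow> f1 * f2 * f3 * f4 \<le> e * B ^ 3"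
      using fB f0 by (auto simp: mult_ac)
    ultimately have "f1 * f2 * f3 * f4 \<le> e * B ^ 3" by blast
    then show "cmod (G z) \<le> e * B ^ 3" by (simp add: G_def norm_mult f1_def f2_def f3_def f4_def)
  qed
  then show ?thesis by (simp add: G_def norm_mult c_def power4_eq_xxxx)
qed

text \<open>\<open>F\<close> equals -1 at the pole in the centre of the square, where Q vanishes.
  Its bounds on the bottom side and on the whole square then give 1 <= e B^3.\<close>

lemma nearest_pole_growth:
  assumes h: "h > 0" and far: "\<And>k. k \<in> {1..m} \<Longrightarrow> h \<le> \<bar>Im (\<xi> k)\<bar>"
    and k0: "k0 \<in> {1..m}" "\<xi> k0 = Complex 0 h" "\<nu> k0 > 0"
    and bound: "\<And>x::real. cmod (spf m \<xi> \<nu> (of_real x)) \<le> M" and Mh: "M * h \<le> 1"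
    and V: "\<And>x. \<bar>x\<bar> \<le> h \<Longrightarrow> (\<Sum>k | k \<in> {1..m} \<and> Im (\<xi> k) < 0. \<nu> k * (\<bar>Im (\<xi> k)\<bar> / (cmod (of_real x - \<xi> k))\<^sup>2)) \<le> V"
  shows "1 \<le> 3 * (M * h) * (1 + exp (M * h + 4 * h * V)) ^ 3"
proof -
  define f where "f = poly (spf_poly m \<xi> \<nu>)"
  define F where "F = (\<lambda>z. f z / f 0 - 1)"
  have nonreal: "Im (\<xi> k) \<noteq> 0" if "k \<in> {1..m}" for k using far[OF that] h by auto
  have M0: "M \<ge> 0" using bound[of 0] norm_ge_zero order_trans by blast
  have f0: "f 0 \<noteq> 0" using nonreal by (force simp: f_def spf_poly_def poly_prod)
  have fc: "f (Complex 0 h) = 0"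
    using k0 by (auto simp: f_def spf_poly_def poly_prod intro!: bexI[of _ k0])
  have "cmod (F (Complex 0 h)) ^ 4 \<le> (3 * (M * h)) * (1 + exp (M * h + 4 * h * V)) ^ 3"
  proof (rule norm_at_square_center_le)
    have "f holomorphic_on UNIV" unfolding f_def spf_poly_def poly_prod poly_power
      by (intro holomorphic_intros)
    then show "F holomorphic_on UNIV" unfolding F_def using f0 by (intro holomorphic_intros) auto
  next
    fix x :: real assume x: "\<bar>x\<bar> \<le> h"
    obtain w where w: "f (of_real x) = f 0 * exp w" "cmod w \<le> M * \<bar>x\<bar>"
      using spf_poly_on_reals[OF nonreal bound] unfolding f_def by blast
    have wle: "cmod w \<le> M * h" using w(2) mult_left_mono[OF x M0] by linarith
    \<comment> \<open>First-order Taylor remainder; with |w| <= Mh <= 1 the exponential factor is at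
      most e < 3.\<close>
    have "cmod (exp w - 1) \<le> exp \<bar>Re w\<bar> * cmod w"
      using Taylor_exp[of w 0] by simp
    also have "\<dots> \<le> exp 1 * (M * h)"
      using wle Mh abs_Re_le_cmod[of w] by (intro mult_mono) auto
    also have "\<dots> \<le> 3 * (M * h)"
      using M0 h e_less_272 by (intro mult_right_mono) auto
    finally show "cmod (F (of_real x)) \<le> 3 * (M * h)" using w(1) f0 by (simp add: F_def)
    fix t assume t: "0 \<le> t" "t \<le> 2 * h"
    have "cmod (f (Complex x t)) \<le> cmod (f (of_real x)) * exp (4 * h * V)"
      unfolding f_def
      by (rule order_trans[OF spf_poly_vertical_growth[OF h far t]])
         (use h V[OF x] in \<open>auto intro!: mult_left_mono\<close>)
    moreover have "cmod (f (of_real x)) \<le> cmod (f 0) * exp (M * h)"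
    proof -
      have "cmod (exp w) \<le> exp (M * h)" using norm_exp[of w] wle by (meson exp_le_cancel_iff order_trans)
      then show ?thesis unfolding w(1) norm_mult by (intro mult_left_mono) auto
    qed
    ultimately have "cmod (f (Complex x t)) \<le> cmod (f 0) * exp (M * h) * exp (4 * h * V)"
      by (meson exp_ge_zero mult_right_mono order_trans)
    then have "cmod (f (Complex x t) / f 0) \<le> exp (M * h + 4 * h * V)"
      using f0 by (simp add: norm_divide exp_add divide_le_eq mult_ac)
    then show "cmod (F (Complex x t)) \<le> 1 + exp (M * h + 4 * h * V)"
      unfolding F_def using norm_triangle_ineq4[of "f (Complex x t) / f 0" 1] by simp
  qed (rule h)
  then show ?thesis using fc by (simp add: F_def)
qed

section \<open>Inequalities for M times a pole height\<close>

text \<open>Translation by \<open>x\<close> and conjugation turn the lower poles into upper ones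
  seen from 0. The kernel estimate applies with y = h and R = n/M, which makes the error n/R equal
  to M. Raising a height v >= h to v + h costs at most a factor 2.\<close>

lemma lower_poles_sum_le:
  fixes x h M :: real
  assumes h: "h > 0" and far: "\<And>k. k \<in> {1..m} \<Longrightarrow> h \<le> \<bar>Im (\<xi> k)\<bar>"
    and bound: "\<And>x::real. cmod (spf m \<xi> \<nu> (of_real x)) \<le> M" and M: "M > 0"
    and n: "n = (\<Sum>k=1..m. \<nu> k)" "M * h < n"
  shows "(\<Sum>k | k \<in> {1..m} \<and> Im (\<xi> k) < 0. \<nu> k * (\<bar>Im (\<xi> k)\<bar> / (cmod (of_real x - \<xi> k))\<^sup>2))
     \<le> 2 * M * (ln (n / (M * h)) + 1)"
proof -
  define \<eta> where "\<eta> = (\<lambda>k. cnj (\<xi> k - of_real x))"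
  have nonreal: "Im (\<eta> k) \<noteq> 0" if "k \<in> {1..m}" for k using far[OF that] h by (auto simp: \<eta>_def)
  have b: "cmod (spf m \<eta> \<nu> (of_real t)) \<le> M" for t
    unfolding \<eta>_def spf_cnj spf_translate using bound[of "t + x"] by simp
  have hR: "h < n / M" using n M by (simp add: field_simps)
  have npos: "n > 0" using n(2) mult_pos_pos[OF M h] by linarith
  have "\<nu> k * (\<bar>Im (\<xi> k)\<bar> / (cmod (of_real x - \<xi> k))\<^sup>2)
       \<le> 2 * (\<nu> k * ((Im (\<eta> k) + h) / ((Re (\<eta> k))\<^sup>2 + (Im (\<eta> k) + h)\<^sup>2)))"
    if k: "k \<in> {1..m}" "Im (\<xi> k) < 0" for k
  proof -
    define u v where "u = Re (\<eta> k)" and "v = Im (\<eta> k)"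
    have v: "v \<ge> h" "\<bar>Im (\<xi> k)\<bar> = v" using far[OF k(1)] k(2) by (auto simp: v_def \<eta>_def)
    have d: "(cmod (of_real x - \<xi> k))\<^sup>2 = u\<^sup>2 + v\<^sup>2"
      by (simp add: u_def v_def \<eta>_def cmod_power2 power2_commute)
    have pos: "u\<^sup>2 + v\<^sup>2 > 0" "u\<^sup>2 + (v + h)\<^sup>2 > 0" using v h by (auto simp: sum_power2_gt_zero_iff)
    have "v * u\<^sup>2 \<le> (2 * (v + h)) * u\<^sup>2" using v h by (intro mult_right_mono) auto
    moreover have "(v * (v + h)) * (v + h) \<le> (v * (v + h)) * (2 * v)" using v h by (intro mult_left_mono) auto
    ultimately have "v * (u\<^sup>2 + (v + h)\<^sup>2) \<le> (2 * (v + h)) * (u\<^sup>2 + v\<^sup>2)"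
      by (simp add: distrib_left power2_eq_square[of v] power2_eq_square[of "v + h"] mult_ac)
    then have "v / (u\<^sup>2 + v\<^sup>2) \<le> 2 * ((v + h) / (u\<^sup>2 + (v + h)\<^sup>2))"
      using pos by (simp add: divide_le_eq le_divide_eq mult_ac)
    then have "\<nu> k * (v / (u\<^sup>2 + v\<^sup>2)) \<le> \<nu> k * (2 * ((v + h) / (u\<^sup>2 + (v + h)\<^sup>2)))"
      by (rule mult_left_mono) simp
    moreover have "\<nu> k * (2 * X) = 2 * (\<nu> k * X)" for X :: real by simp
    ultimately show ?thesis by (simp only: d v(2) u_def v_def)
  qed
  then have "(\<Sum>k | k \<in> {1..m} \<and> Im (\<xi> k) < 0. \<nu> k * (\<bar>Im (\<xi> k)\<bar> / (cmod (of_real x - \<xi> k))\<^sup>2))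
     \<le> (\<Sum>k | k \<in> {1..m} \<and> Im (\<xi> k) < 0. 2 * (\<nu> k * ((Im (\<eta> k) + h) / ((Re (\<eta> k))\<^sup>2 + (Im (\<eta> k) + h)\<^sup>2))))"
    by (intro sum_mono) auto
  also have "\<dots> = 2 * (\<Sum>k | k \<in> {1..m} \<and> Im (\<eta> k) > 0. \<nu> k * ((Im (\<eta> k) + h) / ((Re (\<eta> k))\<^sup>2 + (Im (\<eta> k) + h)\<^sup>2)))"
    unfolding sum_distrib_left by (rule sum.cong) (auto simp: \<eta>_def)
  also have "\<dots> \<le> 2 * (M * ln ((n / M) / h) + real (\<Sum>k=1..m. \<nu> k) / (n / M))"
    by (intro mult_left_mono upper_poles_sum_le nonreal b h hR) auto
  also have "\<dots> = 2 * M * (ln (n / (M * h)) + 1)"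
    unfolding n(1)[symmetric] using npos by (simp add: algebra_simps)
  finally show ?thesis .
qed

text \<open>Keep a single term of the nonnegative sum, with \<open>y\<close> the height of that very
  pole: for real part 0 the term is the multiplicity times 2y/(2y)^2. Again R = n/M.\<close>

lemma pole_multiplicity_le:
  fixes M :: real
  assumes nonreal: "\<And>k. k \<in> {1..m} \<Longrightarrow> Im (\<xi> k) \<noteq> 0"
    and bound: "\<And>x::real. cmod (spf m \<xi> \<nu> (of_real x)) \<le> M" and M: "M > 0"
    and k: "k \<in> {1..m}" and n: "n = (\<Sum>k=1..m. \<nu> k)" "M * \<bar>Im (\<xi> k)\<bar> < n"
  shows "\<nu> k / (2 * (M * \<bar>Im (\<xi> k)\<bar>)) \<le> ln (n / (M * \<bar>Im (\<xi> k)\<bar>)) + 1"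
proof -
  \<comment> \<open>The argument is run for any admissible \<open>\<eta>\<close> with the chosen
    pole moved to the positive imaginary axis; translation, with conjugation if necessary, supplies
    it.\<close>
  have upper: ?thesis if nonreal: "\<And>k. k \<in> {1..m} \<Longrightarrow> Im (\<eta> k) \<noteq> 0"
    and bound: "\<And>x::real. cmod (spf m \<eta> \<nu> (of_real x)) \<le> M"
    and eta: "\<eta> k = Complex 0 \<bar>Im (\<xi> k)\<bar>" for \<eta>
  proof -
    define y where "y = \<bar>Im (\<xi> k)\<bar>"
    have y: "y > 0" using nonreal[OF k] eta by (auto simp: y_def)
    have yR: "y < n / M" using n M by (simp add: y_def field_simps)
    have npos: "n > 0" using n(2) mult_pos_pos[OF M y] unfolding y_def by linarith
    have "\<nu> k * ((Im (\<eta> k) + y) / ((Re (\<eta> k))\<^sup>2 + (Im (\<eta> k) + y)\<^sup>2))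
      \<le> (\<Sum>k | k \<in> {1..m} \<and> Im (\<eta> k) > 0. \<nu> k * ((Im (\<eta> k) + y) / ((Re (\<eta> k))\<^sup>2 + (Im (\<eta> k) + y)\<^sup>2)))"
      by (rule member_le_sum[of k "{k. k \<in> {1..m} \<and> Im (\<eta> k) > 0}"
            "\<lambda>k. \<nu> k * ((Im (\<eta> k) + y) / ((Re (\<eta> k))\<^sup>2 + (Im (\<eta> k) + y)\<^sup>2))"])
         (use k y in \<open>auto simp: eta y_def[symmetric]\<close>)
    also have "\<dots> \<le> M * ln ((n / M) / y) + real (\<Sum>k=1..m. \<nu> k) / (n / M)"
      by (intro upper_poles_sum_le nonreal bound y yR)
    also have "\<dots> = M * (ln (n / (M * y)) + 1)"
      unfolding n(1)[symmetric] using npos by (simp add: algebra_simps)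
    finally have "\<nu> k / (2 * y) \<le> M * (ln (n / (M * y)) + 1)"
      using y by (simp add: eta y_def[symmetric] power2_eq_square)
    then have "\<nu> k / (2 * y) / M \<le> ln (n / (M * y)) + 1"
      by (subst pos_divide_le_eq[OF M]) (simp add: mult.commute)
    moreover have "\<nu> k / (2 * y) / M = \<nu> k / (2 * (M * y))" by (simp add: mult_ac)
    ultimately show ?thesis by (simp only: y_def)
  qed
  show ?thesis
  proof (cases "Im (\<xi> k) > 0")
    case True
    show ?thesis
    proof (rule upper)
      show "cmod (spf m (\<lambda>j. \<xi> j - of_real (Re (\<xi> k))) \<nu> (of_real x)) \<le> M" for x
        unfolding spf_translate using bound[of "x + Re (\<xi> k)"] by simp
    qed (use nonreal True in \<open>auto simp: complex_eq_iff\<close>)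
  next
    case False
    show ?thesis
    proof (rule upper)
      show "cmod (spf m (\<lambda>j. cnj (\<xi> j - of_real (Re (\<xi> k)))) \<nu> (of_real x)) \<le> M" for x
        unfolding spf_cnj spf_translate using bound[of "x + Re (\<xi> k)"] by simp
    qed (use nonreal False in \<open>auto simp: complex_eq_iff\<close>)
  qed
qed

text \<open>The growth inequality with V = 2M (ln (n/(Mh)) + 1) from the lower poles, so that 4hV
  carries the factor 8Mh.\<close>

lemma nearest_pole_inequality:
  fixes M :: real
  assumes h: "h > 0" and far: "\<And>k. k \<in> {1..m} \<Longrightarrow> h \<le> \<bar>Im (\<xi> k)\<bar>"
    and bound: "\<And>x::real. cmod (spf m \<xi> \<nu> (of_real x)) \<le> M" and M: "M > 0"
    and k0: "k0 \<in> {1..m}" "\<bar>Im (\<xi> k0)\<bar> = h" "\<nu> k0 > 0"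
    and n: "n = (\<Sum>k=1..m. \<nu> k)" "M * h < n" and Mh: "M * h \<le> 1"
  shows "1 \<le> 3 * (M * h) * (1 + exp (M * h + 8 * (M * h) * (ln (n / (M * h)) + 1))) ^ 3"
proof -
  have upper: ?thesis if far: "\<And>k. k \<in> {1..m} \<Longrightarrow> h \<le> \<bar>Im (\<eta> k)\<bar>"
    and bound: "\<And>x::real. cmod (spf m \<eta> \<nu> (of_real x)) \<le> M"
    and eta: "\<eta> k0 = Complex 0 h" for \<eta>
    using nearest_pole_growth[OF h far k0(1) eta k0(3) bound Mh lower_poles_sum_le[OF h far bound M n]]
    by (simp add: mult_ac)
  show ?thesis
  proof (cases "Im (\<xi> k0) > 0")
    case True
    show ?thesis
    proof (rule upper)
      show "cmod (spf m (\<lambda>j. \<xi> j - of_real (Re (\<xi> k0))) \<nu> (of_real x)) \<le> M" for x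
        unfolding spf_translate using bound[of "x + Re (\<xi> k0)"] by simp
    qed (use far k0 True in \<open>auto simp: complex_eq_iff\<close>)
  next
    case False
    show ?thesis
    proof (rule upper)
      show "cmod (spf m (\<lambda>j. cnj (\<xi> j - of_real (Re (\<xi> k0)))) \<nu> (of_real x)) \<le> M" for x
        unfolding spf_cnj spf_translate using bound[of "x + Re (\<xi> k0)"] by simp
    qed (use far k0 False in \<open>auto simp: complex_eq_iff\<close>)
  qed
qed

section \<open>Solving the inequalities, and bounds for coth\<close>

text \<open>The maximum is 1/e, attained at Y = 1/e. Splitting ln (n/Y) as ln n + ln (1/Y), this
  makes the second part harmless once multiplied by \<open>Y\<close>.\<close>

lemma mult_ln_inverse_le:
  fixes Y :: real
  assumes "Y > 0"
  shows "Y * ln (1 / Y) \<le> 2 / 5"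
proof -
  have e: "exp 1 \<ge> (5 / 2 :: real)"
    using exp_lower_Taylor_quadratic[of 1] by simp
  have "ln (1 / (exp 1 * Y)) \<le> 1 / (exp 1 * Y) - 1" using assms by (intro ln_le_minus_one) simp
  moreover have "ln (1 / (exp 1 * Y)) = ln (1 / Y) - 1" using assms by (simp add: ln_div ln_mult)
  ultimately have "ln (1 / Y) \<le> 1 / (exp 1 * Y)" by simp
  then have "Y * ln (1 / Y) \<le> Y * (1 / (exp 1 * Y))" using assms by (intro mult_left_mono) auto
  also have "\<dots> = 1 / exp 1" using assms by simp
  also have "\<dots> \<le> 2 / 5" using e by (simp add: divide_le_eq)
  finally show ?thesis .
qed

lemma ln_gt_1:
  fixes n :: real
  assumes "n \<ge> 4"
  shows "ln n > 1"
proof -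
  have "exp 1 < n" using e_less_272 assms by linarith
  then show ?thesis using assms by (metis exp_gt_zero ln_exp ln_less_cancel_iff order_less_trans)
qed

lemma multiplicity_bound_solved:
  fixes Y n p :: real
  assumes n: "n \<ge> 4" and p: "1 \<le> p" "p \<le> n" and Y: "Y > 0"
    and ineq: "Y < n \<Longrightarrow> p / (2 * Y) \<le> ln (n / Y) + 1"
  shows "p / (20 * ln n) \<le> Y"
proof (cases "Y < n")
  case False
  have "p / (20 * ln n) \<le> p / 1" using ln_gt_1[OF n] p n by (intro divide_left_mono) auto
  then show ?thesis using False p by simp
next
  case True
  define L where "L = ln n"
  have L: "L > 1" using ln_gt_1[OF n] by (simp add: L_def)
  have "ln (n / Y) = L + ln (1 / Y)" using n Y by (simp add: ln_div L_def)
  then have "p \<le> (L + ln (1 / Y) + 1) * (2 * Y)" using ineq[OF True] Y by (simp add: divide_le_eq)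
  \<comment> \<open>The right side is at most 4YL + 4/5. Since p >= 1, p - 4/5 is at least p/5,
    whence the constant 20.\<close>
  then have "p \<le> 2 * (Y * L) + 2 * (Y * ln (1 / Y)) + 2 * Y" by (simp add: algebra_simps)
  moreover have "Y * 1 \<le> Y * L" using L Y by (intro mult_left_mono) auto
  ultimately have "p \<le> 20 * (Y * L)" using mult_ln_inverse_le[OF Y] p(1) by linarith
  then show ?thesis using L unfolding L_def[symmetric] by (simp add: divide_le_eq mult_ac)
qed

text \<open>If \<open>Y\<close> were smaller, the logarithm of the inequality would fail: ln (3Y)
  lies below -43 + ln (ln L) - ln L, while the other terms add at most 42 + 24YL. Here ln (ln L)
  takes at most half of ln L and 24YL at most 24/132 of it.\<close>

lemma loglog_bound_solved:
  fixes Y n :: real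
  assumes n: "n \<ge> 4" and Y: "Y > 0"
    and ineq: "Y \<le> 1 \<Longrightarrow> 1 \<le> 3 * Y * (1 + exp (Y + 8 * Y * (ln (n / Y) + 1))) ^ 3"
  shows "exp (-43) / 3 * (ln (ln n) / ln n) \<le> Y"
proof (rule ccontr)
  define L where "L = ln n"
  define c where "c = exp (-43) / (3 :: real)"
  assume "\<not> exp (-43) / 3 * (ln (ln n) / ln n) \<le> Y"
  then have Yc: "Y < c * (ln L / L)" by (simp add: L_def c_def)
  have L: "L > 1" using ln_gt_1[OF n] by (simp add: L_def)
  have lnL: "ln L > 0" using L by simp
  have "exp 43 \<ge> (44 :: real)" using exp_ge_add_one_self[of "43 :: real"] by simp
  then have c: "0 < c" "c \<le> 1 / 132"
    by (auto simp: c_def exp_minus divide_simps)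
  have lnL_le: "ln L / L \<le> 1" using L ln_le_minus_one[of L] by (simp add: divide_le_eq)
  have "c * (ln L / L) \<le> c * 1" using c lnL_le by (intro mult_left_mono) auto
  then have Y1: "Y \<le> 1" using Yc c by linarith
  define X where "X = Y + 8 * Y * (ln (n / Y) + 1)"
  have X_eq: "X = 9 * Y + 8 * (Y * L) + 8 * (Y * ln (1 / Y))"
    using n Y by (simp add: X_def ln_div L_def algebra_simps)
  have "ln (1 / Y) \<ge> 0" using Y Y1 by (simp add: ln_div)
  then have X0: "X \<ge> 0" unfolding X_eq using Y L by simp
  \<comment> \<open>This makes the logarithm of the cube linear in \<open>X\<close>; it uses X >=
    0.\<close>
  have "1 + exp X \<le> exp 1 * exp X"
  proof -
    have "2 * exp X \<le> exp 1 * exp X" using exp_ge_add_one_self[of "1::real"] by (intro mult_right_mono) auto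
    then show ?thesis using X0 by (smt (verit) one_le_exp_iff)
  qed
  then have lnX: "ln (1 + exp X) \<le> 1 + X"
    by (metis add_pos_pos exp_add exp_gt_zero ln_exp ln_mono zero_less_one)
  have "1 \<le> 3 * Y * (1 + exp X) ^ 3" using ineq[OF Y1] by (simp add: X_def)
  then have "0 \<le> ln (3 * Y * (1 + exp X) ^ 3)" by simp
  also have "\<dots> = ln (3 * Y) + 3 * ln (1 + exp X)"
  proof -
    have "1 + exp X > 0" by (simp add: add_pos_pos)
    then show ?thesis using Y by (subst ln_mult) (auto simp: ln_realpow)
  qed
  finally have "0 \<le> ln (3 * Y) + 3 * (1 + X)" using lnX by simp
  then have "0 \<le> ln (3 * Y) + 3 + 27 * Y + 24 * (Y * L) + 24 * (Y * ln (1 / Y))"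
    unfolding X_eq by (simp only: distrib_left mult.assoc[symmetric])
  \<comment> \<open>With Y <= 1 the constants amount to 3 + 27 + 24 * 2/5 < 42.\<close>
  then have A: "0 \<le> ln (3 * Y) + 42 + 24 * (Y * L)"
    using mult_ln_inverse_le[OF Y] Y1 by argo
  have "Y * L < c * ln L" using Yc L by (simp add: less_divide_eq)
  moreover have "c * ln L \<le> 1 / 132 * ln L" using c lnL by (intro mult_right_mono) auto
  ultimately have B: "Y * L \<le> 1 / 132 * ln L" by linarith
  have "3 * Y < exp (-43) * (ln L / L)" using Yc by (simp add: c_def)
  then have "ln (3 * Y) < ln (exp (-43) * (ln L / L))" using Y L lnL by (subst ln_less_cancel_iff) auto
  also have "\<dots> = -43 + ln (ln L) - ln L" using L lnL by (simp add: ln_mult ln_div)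
  finally have C: "ln (3 * Y) < -43 + ln (ln L) - ln L" .
  have "ln (ln L / 2) \<le> ln L / 2 - 1" using lnL by (intro ln_le_minus_one) auto
  moreover have "ln (ln L / 2) = ln (ln L) - ln 2" using lnL by (simp add: ln_div)
  moreover have "ln 2 \<le> (1::real)" using ln_le_minus_one[of "2::real"] by simp
  ultimately have "ln (ln L) \<le> ln L / 2" by linarith
  then show False using A B C lnL by linarith
qed

text \<open>The quotient is coth (u/2). The upper bound follows from exp u - 1 >= u and splits the
  target into two simple terms; the strict lower bound yields the last inequality of the
  theorem.\<close>

lemma coth_bounds:
  fixes u :: real
  assumes u: "u > 0"
  shows "(exp u + 1) / (exp u - 1) \<le> 1 + 2 / u" "2 / u < (exp u + 1) / (exp u - 1)"
proof -
  have e: "exp u - 1 > 0" using u by simp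
  have "2 / (exp u - 1) \<le> 2 / u"
    using u e exp_ge_add_one_self[of u] by (intro divide_left_mono mult_pos_pos) linarith+
  moreover have "(exp u + 1) / (exp u - 1) = 1 + 2 / (exp u - 1)" using e by (simp add: field_simps)
  ultimately show "(exp u + 1) / (exp u - 1) \<le> 1 + 2 / u" by simp
  \<comment> \<open>Clearing denominators in the lower bound leaves positivity of
    \<open>\<phi>\<close>, which vanishes at 0 and increases.\<close>
  define \<phi> where "\<phi> = (\<lambda>t::real. t * (exp t + 1) - 2 * (exp t - 1))"
  have "\<phi> 0 < \<phi> u"
  proof (rule DERIV_pos_imp_increasing_open[OF u])
    fix t :: real assume t: "0 < t" "t < u"
    have "(\<phi> has_real_derivative (1 - (1 - t) * exp t)) (at t)"
      unfolding \<phi>_def by (auto intro!: derivative_eq_intros simp: algebra_simps)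
    moreover have "1 - (1 - t) * exp t > 0"
    proof -
      have "1 + (- t) < exp (- t)" using exp_minus_greater[of t] t by simp
      then have "(1 - t) * exp t < exp (- t) * exp t" by (intro mult_strict_right_mono) auto
      then show ?thesis by (simp add: exp_minus)
    qed
    ultimately show "\<exists>y. (\<phi> has_real_derivative y) (at t) \<and> 0 < y" by blast
  qed (auto simp: \<phi>_def intro!: continuous_intros)
  then show "2 / u < (exp u + 1) / (exp u - 1)"
    using u e by (simp add: \<phi>_def divide_less_eq less_divide_eq mult_ac)
qed

section \<open>The lower bound for every pole and the passage to the essential supremum\<close>

text \<open>The average of two bounds on \<open>Y\<close>: the double logarithm, proved for a
  nearest pole and inherited by all higher ones, and the multiplicity bound at the pole itself.
  Averaging turns exp (-43)/3 into exp (-43)/6.\<close>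

lemma pole_height_ge:
  fixes M :: real and n :: nat
  assumes n: "n = (\<Sum>k=1..m. \<nu> k)" "n \<ge> 4"
    and nonreal: "\<And>k. k \<in> {1..m} \<Longrightarrow> Im (\<xi> k) \<noteq> 0"
    and nu: "\<And>k. k \<in> {1..m} \<Longrightarrow> \<nu> k > 0"
    and bound: "\<And>x::real. cmod (spf m \<xi> \<nu> (of_real x)) \<le> M" and M: "M > 0"
    and k: "k \<in> {1..m}"
  shows "exp (-43) / 6 * ((ln (ln n) + 2 * \<nu> k) / ln n) \<le> \<bar>Im (\<xi> k)\<bar> * M"
proof -
  define L where "L = ln (real n)"
  define Y where "Y = M * \<bar>Im (\<xi> k)\<bar>"
  have n4: "real n \<ge> 4" using n(2) by simp
  have L: "L > 1" using ln_gt_1[OF n4] by (simp add: L_def)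
  have Y0: "Y > 0" using nonreal[OF k] M by (simp add: Y_def)
  have nsum: "real n = real (\<Sum>k=1..m. \<nu> k)" using n(1) by simp
  have "\<nu> k \<le> n" unfolding n(1) by (rule member_le_sum) (use k in auto)
  then have 1: "\<nu> k / (20 * L) \<le> Y"
    unfolding L_def using nu[OF k]
    by (intro multiplicity_bound_solved[OF n4 _ _ Y0])
       (auto simp: Y_def intro!: pole_multiplicity_le[OF nonreal bound M k nsum])
  define h where "h = Min ((\<lambda>k. \<bar>Im (\<xi> k)\<bar>) ` {1..m})"
  have "h \<in> (\<lambda>k. \<bar>Im (\<xi> k)\<bar>) ` {1..m}" unfolding h_def using k by (intro Min_in) auto
  then obtain k0 where k0: "k0 \<in> {1..m}" "\<bar>Im (\<xi> k0)\<bar> = h" by auto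
  have far: "h \<le> \<bar>Im (\<xi> j)\<bar>" if "j \<in> {1..m}" for j unfolding h_def using that by (intro Min_le) auto
  have h: "h > 0" using nonreal[OF k0(1)] k0(2) by auto
  have 2: "exp (-43) / 3 * (ln L / L) \<le> M * h" unfolding L_def
  proof (rule loglog_bound_solved[OF n4])
    assume le1: "M * h \<le> 1"
    have Mhn: "M * h < real n" using le1 n4 by linarith
    show "1 \<le> 3 * (M * h) * (1 + exp (M * h + 8 * (M * h) * (ln (real n / (M * h)) + 1))) ^ 3"
      by (rule nearest_pole_inequality[OF h far bound M k0 nu[OF k0(1)] nsum Mhn le1])
  qed (use M h in simp)
  have "M * h \<le> Y" unfolding Y_def using far[OF k] M by (intro mult_left_mono) auto
  with 2 have 3: "exp (-43) / 3 * (ln L / L) \<le> Y" by linarith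
  have "exp 43 \<ge> (44 :: real)" using exp_ge_add_one_self[of "43 :: real"] by simp
  \<comment> \<open>Half of the multiplicity constant 1/20, since that bound is to fill only
    Y/2.\<close>
  then have "exp (-43) / 3 \<le> (1 / 40 :: real)" by (simp add: exp_minus divide_simps)
  then have "exp (-43) / 3 * (\<nu> k / L) \<le> 1 / 40 * (\<nu> k / L)" using L by (intro mult_right_mono) auto
  also have "\<dots> \<le> Y / 2" using 1 by simp
  finally have 4: "exp (-43) / 3 * (\<nu> k / L) \<le> Y / 2" .
  have "exp (-43) / 6 * ((ln L + 2 * \<nu> k) / L) = exp (-43) / 3 * (ln L / L) / 2 + exp (-43) / 3 * (\<nu> k / L)"
    by (simp add: add_divide_distrib distrib_left)
  also have "\<dots> \<le> Y / 2 + Y / 2" by (intro add_mono divide_right_mono 3 4) simp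
  finally show ?thesis by (simp add: Y_def L_def mult.commute)
qed

text \<open>By continuity the set where the modulus exceeds \<open>M\<close> is open, and a nonempty
  open set is not a null set.\<close>

lemma norm_le_of_Linf_norm_le:
  assumes cont: "continuous_on UNIV f" and le: "Linf_norm f \<le> ereal M"
  shows "cmod (f x) \<le> M"
proof (rule ccontr)
  define A where "A = {x. M < cmod (f x)}"
  assume "\<not> cmod (f x) \<le> M"
  then have "x \<in> A" by (simp add: A_def)
  then have "A \<noteq> {}" by blast
  have "open A" unfolding A_def using cont by (intro open_Collect_less continuous_intros)
  have "AE x in lebesgue. ereal (cmod (f x)) \<le> Linf_norm f"
    unfolding Linf_norm_def by (rule esssup_AE)
  then have "AE x in lebesgue. x \<notin> A"
  proof eventually_elim
    case (elim x)
    then have "ereal (cmod (f x)) \<le> ereal M" using le by (rule order_trans)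
    then show ?case by (simp add: A_def)
  qed
  then obtain N where "negligible N" "{x. \<not> x \<notin> A} \<subseteq> N"
    unfolding eventually_ae_filter_negligible by blast
  then have "negligible A" by (auto intro: negligible_subset)
  then show False using open_not_negligible \<open>open A\<close> \<open>A \<noteq> {}\<close> by blast
qed

theorem theorem1:
  "\<exists>c::real. c > 0 \<and>
     (\<forall>(n::nat) (m::nat) (\<xi>::nat \<Rightarrow> complex) (\<nu>::nat \<Rightarrow> nat).
        n \<ge> 4 \<longrightarrow>
        n = (\<Sum>k=1..m. \<nu> k) \<longrightarrow>
        inj_on \<xi> {1..m} \<longrightarrow>
        (\<forall>k\<in>{1..m}. \<xi> k \<notin> \<real>) \<longrightarrow>
        (\<forall>k\<in>{1..m}. \<nu> k > 0) \<longrightarrow>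
        (\<forall>k\<in>{1..m}.
           ereal \<bar>Im (\<xi> k)\<bar> * Linf_norm (\<lambda>x::real. spf m \<xi> \<nu> (complex_of_real x))
             \<ge> ereal (c * ((ln (real n) powr (1 / real (\<nu> k)) + 1) /
                           (ln (real n) powr (1 / real (\<nu> k)) - 1)) *
                      (ln (ln (real n)) / ln (real n)))
         \<and> c * ((ln (real n) powr (1 / real (\<nu> k)) + 1) /
                (ln (real n) powr (1 / real (\<nu> k)) - 1)) *
              (ln (ln (real n)) / ln (real n))
             > 2 * c * (real (\<nu> k) / ln (real n))))"
proof (intro exI[of _ "exp (-43) / 6"] conjI allI impI ballI)
  show "exp (-43) / 6 > (0::real)" by simp
next
  fix n m :: nat and \<xi> :: "nat \<Rightarrow> complex" and \<nu> :: "nat \<Rightarrow> nat" and k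
  assume n: "n \<ge> 4" "n = (\<Sum>k=1..m. \<nu> k)" and nonreal: "\<forall>k\<in>{1..m}. \<xi> k \<notin> \<real>"
    and nu: "\<forall>k\<in>{1..m}. \<nu> k > 0" and k: "k \<in> {1..m}"
  define c where "c = exp (-43) / (6::real)"
  define L where "L = ln (real n)"
  define p where "p = real (\<nu> k)"
  \<comment> \<open>With this \<open>u\<close> the power L^(1/p) is exp u, so the quotient in the
    theorem is coth (u/2).\<close>
  define u where "u = ln L / p"
  define B where "B = c * ((L powr (1 / p) + 1) / (L powr (1 / p) - 1)) * (ln L / L)"
  have c: "c > 0" by (simp add: c_def)
  have p: "p > 0" using nu k by (simp add: p_def)
  have L: "L > 1" using ln_gt_1[of "real n"] n(1) by (simp add: L_def)
  then have lnL: "ln L > 0" by simp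
  have u: "u > 0" using lnL p by (simp add: u_def)
  have B_eq: "B = (exp u + 1) / (exp u - 1) * (c * (ln L / L))"
    using L by (simp add: B_def u_def powr_def)
  have pos: "c * (ln L / L) > 0" using c L lnL by simp
  have "2 / u * (c * (ln L / L)) < B"
    unfolding B_eq using coth_bounds(2)[OF u] pos by (rule mult_strict_right_mono)
  moreover have "2 / u * (c * (ln L / L)) = 2 * c * (p / L)"
    using lnL p by (simp add: u_def)
  ultimately have lower: "2 * c * (p / L) < B" by simp
  then have B0: "B > 0" using c p L by (smt (verit) divide_pos_pos mult_pos_pos)
  have "B \<le> (1 + 2 / u) * (c * (ln L / L))"
    unfolding B_eq using coth_bounds(1)[OF u] pos by (intro mult_right_mono) auto
  also have "\<dots> = c * ((ln L + 2 * p) / L)"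
    using lnL p L by (simp add: u_def field_simps)
  finally have upper: "B \<le> c * ((ln L + 2 * p) / L)" .
  define y where "y = \<bar>Im (\<xi> k)\<bar>"
  have nonreal': "Im (\<xi> j) \<noteq> 0" if "j \<in> {1..m}" for j
    using nonreal that by (auto simp: complex_is_Real_iff)
  have y: "y > 0" using nonreal'[OF k] by (simp add: y_def)
  define X where "X = Linf_norm (\<lambda>x::real. spf m \<xi> \<nu> (complex_of_real x))"
  have "ereal B \<le> ereal y * X"
  proof (rule ccontr)
    assume "\<not> ereal B \<le> ereal y * X"
    then have "X < ereal (B / y)" using y by (cases X) (auto simp: field_simps)
    \<comment> \<open>A real \<open>M\<close> strictly below B/y is needed in place of the extended
      real norm; comparing with 0 as well makes it positive, as the choice R = n/M requires.\<close>
    then have "max X 0 < ereal (B / y)" using B0 y by simp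
    then obtain z where "max X 0 < z" "z < ereal (B / y)" using dense by blast
    then obtain M where M: "X \<le> ereal M" "M > 0" "M < B / y"
      by (cases z) (auto intro: less_imp_le)
    have "complex_of_real x \<noteq> \<xi> j" if "j \<in> {1..m}" for x j
      using nonreal'[OF that] by (metis Im_complex_of_real)
    then have "continuous_on UNIV (\<lambda>x::real. spf m \<xi> \<nu> (complex_of_real x))"
      unfolding spf_def by (intro continuous_intros) auto
    then have bound: "cmod (spf m \<xi> \<nu> (of_real x)) \<le> M" for x
      using norm_le_of_Linf_norm_le M(1) unfolding X_def by blast
    have "c * ((ln L + 2 * p) / L) \<le> y * M"
      unfolding c_def L_def p_def y_def
      by (rule pole_height_ge[OF n(2,1) nonreal' _ bound M(2) k]) (use nu in auto)
    moreover have "y * M < B" using M(3) y by (simp add: field_simps)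
    ultimately show False using upper by linarith
  qed
  then show "ereal (exp (-43) / 6 * ((ln (real n) powr (1 / real (\<nu> k)) + 1) /
                           (ln (real n) powr (1 / real (\<nu> k)) - 1)) *
                      (ln (ln (real n)) / ln (real n)))
      \<le> ereal \<bar>Im (\<xi> k)\<bar> * Linf_norm (\<lambda>x::real. spf m \<xi> \<nu> (complex_of_real x))"
    unfolding B_def c_def L_def p_def y_def X_def .
  show "2 * (exp (-43) / 6) * (real (\<nu> k) / ln (real n)) <
     exp (-43) / 6 * ((ln (real n) powr (1 / real (\<nu> k)) + 1) /
                (ln (real n) powr (1 / real (\<nu> k)) - 1)) *
              (ln (ln (real n)) / ln (real n))"
    using lower unfolding B_def c_def L_def p_def .
qed

end
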